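(* Let $n\ge 1$. Every vital rank-one POVM on $\mathbb{R}^n$ has size at most $\binom{n+1}{2}$, and every vital rank-one POVM on $\mathbb{C}^n$ has size at most $n^2$. Moreover, these bounds are sharp for all $n$: for every $n\ge 1$ there exist a vital rank-one POVM on $\mathbb{R}^n$ of size exactly $\binom{n+1}{2}$ and a vital rank-one POVM on $\mathbb{C}^n$ of size exactly $n^2$.
   Context: Let $\mathbb{K}$ be $\mathbb{R}$ or $\mathbb{C}$. A POVM on $\mathbb{K}^n$ is a finite indexed family $\mathcal{E}=\{E_i\}_{i=1}^m$ of positive semidefinite operators on $\mathbb{K}^n$ (real symmetric if $\mathbb{K}=\mathbb{R}$, Hermitian if $\mathbb{K}=\mathbb{C}$) with $\sum_{i=1}^m E_i=I$; its size is $m$. It is rank-one if every $E_i$ has rank $1$. A pure state is an operator $\operatorname{proj}(\psi)=\psi\psi^*$ with $\psi\in\mathbb{K}^n$ a unit vector. $\mathcal{E}$ is PSI-Complete if for all unit vectors $\psi,\phi\in\mathbb{K}^n$, the equalities $\operatorname{Tr}(\operatorname{proj}(\psi)E_i)=\operatorname{Tr}(\operatorname{proj}(\phi)E_i)$ for all $i$ imply $\operatorname{proj}(\psi)=\operatorname{proj}(\phi)$. For an index $j$ put $S_j=\sum_{i\ne j}E_i=I-E_j$ and $\mathcal{D}_j=\{\rho \text{ pure state}: \operatorname{Tr}(\rho S_j)>0\}$. The subcollection $\{E_i\}_{i\ne j}$ is called PSI-Complete if the map $\mathcal{D}_j\to\mathbb{R}^{m-1}$, $\rho\mapsto\big(\operatorname{Tr}(\rho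 E_i)/\operatorname{Tr}(\rho S_j)\big)_{i\ne j}$, is injective. Convention: if $S_j=0$ (so that $\mathcal{D}_j=\emptyset$), the subcollection is not regarded as PSI-Complete. A rank-one POVM $\mathcal{E}=\{E_i\}_{i=1}^m$ is vital if it is PSI-Complete but for every $j\in\{1,\dots,m\}$ the subcollection $\{E_i\}_{i\ne j}$ is not PSI-Complete. *)

theory Defs
  imports "HOL-Analysis.Analysis" "Jordan_Normal_Form.Conjugate"
begin

text \<open>
  The scalar field is a type of sort real_normed_field, conjugatable_ordered_field; only the
  instances real and complex are used. On complex, the order is the one of Complex_Order:
  0 \<le> z means that z is real and nonnegative, and 0 < z that z is real and positive.
  An operator on the n-dimensional space is its matrix in the standard basis.
\<close>

definition conj_transpose :: "'a::conjugate^'n^'m \<Rightarrow> 'a^'m^'n" where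
  "conj_transpose A = (\<chi> i j. conjugate (A $ j $ i))"

definition hermitian_matrix :: "'a::conjugate^'n^'n \<Rightarrow> bool" where
  "hermitian_matrix A \<longleftrightarrow> conj_transpose A = A"

definition psd_matrix :: "'a::conjugatable_ordered_field^'n^'n \<Rightarrow> bool" where
  "psd_matrix A \<longleftrightarrow>
     hermitian_matrix A \<and> (\<forall>x. 0 \<le> (\<Sum>i\<in>UNIV. conjugate (x $ i) * (A *v x) $ i))"

text \<open>A family of size m is indexed by 1, ..., m; values at other indices are irrelevant.\<close>

definition povm :: "nat \<Rightarrow> (nat \<Rightarrow> 'a::conjugatable_ordered_field^'n^'n) \<Rightarrow> bool" where
  "povm m E \<longleftrightarrow> (\<forall>i\<in>{1..m}. psd_matrix (E i)) \<and> (\<Sum>i=1..m. E i) = mat 1"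

definition rank_one_povm :: "nat \<Rightarrow> (nat \<Rightarrow> 'a::conjugatable_ordered_field^'n^'n) \<Rightarrow> bool" where
  "rank_one_povm m E \<longleftrightarrow> povm m E \<and> (\<forall>i\<in>{1..m}. rank (E i) = 1)"

definition proj :: "'a::{conjugate,times}^'n \<Rightarrow> 'a^'n^'n" where
  "proj \<psi> = (\<chi> i j. \<psi> $ i * conjugate (\<psi> $ j))"

definition pure_states :: "('a::{real_normed_field,conjugatable_ordered_field}^'n^'n) set" where
  "pure_states = {proj \<psi> | \<psi>. norm \<psi> = 1}"

definition psi_complete ::
  "nat \<Rightarrow> (nat \<Rightarrow> 'a::{real_normed_field,conjugatable_ordered_field}^'n^'n) \<Rightarrow> bool" where
  "psi_complete m E \<longleftrightarrow>
     (\<forall>\<psi> \<phi>. norm \<psi> = 1 \<longrightarrow> norm \<phi> = 1 \<longrightarrow>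
        (\<forall>i\<in>{1..m}. trace (proj \<psi> ** E i) = trace (proj \<phi> ** E i)) \<longrightarrow> proj \<psi> = proj \<phi>)"

definition sum_without :: "nat \<Rightarrow> (nat \<Rightarrow> 'a::comm_monoid_add^'n^'n) \<Rightarrow> nat \<Rightarrow> 'a^'n^'n" where
  "sum_without m E j = (\<Sum>i\<in>{1..m} - {j}. E i)"

definition detected_states ::
  "nat \<Rightarrow> (nat \<Rightarrow> 'a::{real_normed_field,conjugatable_ordered_field}^'n^'n) \<Rightarrow> nat
     \<Rightarrow> ('a^'n^'n) set" where
  "detected_states m E j = {\<rho> \<in> pure_states. trace (\<rho> ** sum_without m E j) > 0}"

text \<open>
  PSI-completeness of the subcollection omitting index j. Injectivity on the empty set is vacuous,
  so the case where the remaining elements sum to zero is excluded by convention.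
  The probabilities are taken in the scalar field; for positive semidefinite families they are real.
\<close>

definition psi_complete_without ::
  "nat \<Rightarrow> (nat \<Rightarrow> 'a::{real_normed_field,conjugatable_ordered_field}^'n^'n) \<Rightarrow> nat \<Rightarrow> bool" where
  "psi_complete_without m E j \<longleftrightarrow>
     sum_without m E j \<noteq> 0 \<and>
     inj_on (\<lambda>\<rho>. \<lambda>i\<in>{1..m} - {j}. trace (\<rho> ** E i) / trace (\<rho> ** sum_without m E j))
       (detected_states m E j)"

definition vital_rank_one_povm ::
  "nat \<Rightarrow> (nat \<Rightarrow> 'a::{real_normed_field,conjugatable_ordered_field}^'n^'n) \<Rightarrow> bool" where
  "vital_rank_one_povm m E \<longleftrightarrow>
     rank_one_povm m E \<and> psi_complete m E \<and> (\<forall>j\<in>{1..m}. \<not> psi_complete_without m E j)"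

end

theory Submission
  imports Defs
begin

text \<open>
  If \<open>E j\<close> lies in the real span of the other elements of a PSI-complete rank-one POVM, then
  proportional statistics of two pure states on the others are proportional on \<open>E j\<close> as well, hence
  equal since each state has trace one; so \<open>E j\<close> could be removed. A vital POVM is therefore
  linearly independent in the space of Hermitian matrices.

  Conversely, removing an element from a rank-one basis of the Hermitian matrices destroys
  PSI-completeness as soon as its dual basis element has exactly one positive and one negative
  eigenvalue, because then it is a difference of multiples of two pure states. For suitable phases
  \<open>\<omega>\<close>, the rank-one operators of the vectors \<open>e_p\<close> and \<open>e_p + \<omega> e_q\<close> have this property in
  dimension at least two, and it is invariant under the congruence that turns their sum into the
  identity.
\<close>

section \<open>Scalars and rank-one operators\<close>

text \<open>Lets the argument run over both scalar fields at once: the axioms tie norm, conjugation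
  and order to the embedded reals.\<close>

class real_or_complex = real_normed_field + conjugatable_ordered_field +
  assumes mult_conjugate_scaleR: "x * conjugate x = scaleR ((norm x)\<^sup>2) 1"
    and conjugate_scaleR_one: "conjugate (scaleR r 1) = scaleR r 1"
    and scaleR_one_nonneg: "0 \<le> scaleR r 1 \<longleftrightarrow> 0 \<le> r"

instance real :: real_or_complex
  by standard (simp_all add: power2_eq_square)

instance complex :: real_or_complex
proof
  fix x :: complex
  show "x * conjugate x = scaleR ((norm x)\<^sup>2) 1"
    by (simp only: conjugate_complex_def complex_norm_square[symmetric] scaleR_conv_of_real
        mult_1_right)
qed (simp_all add: less_eq_complex_def)

context
  fixes x y :: "'a::real_or_complex"
begin

lemma mult_conjugate: "x * conjugate x = of_real ((norm x)\<^sup>2)"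
  by (simp only: mult_conjugate_scaleR of_real_def)

lemma conjugate_of_real [simp]: "conjugate (of_real r :: 'a) = of_real r"
  by (simp only: conjugate_scaleR_one of_real_def)

lemma of_real_nonneg_iff: "(0::'a) \<le> of_real r \<longleftrightarrow> 0 \<le> r"
  by (simp only: scaleR_one_nonneg of_real_def)

lemma of_real_pos_iff: "(0::'a) < of_real r \<longleftrightarrow> 0 < r"
  using of_real_nonneg_iff[of r] by (auto simp: order.order_iff_strict)

lemma conjugate_one [simp]: "conjugate (1::'a) = 1"
  using conjugate_scaleR_one[of 1, where 'a='a] by simp

lemma conjugate_numeral [simp]: "conjugate (numeral w :: 'a) = numeral w"
  using conjugate_of_real[of "numeral w"] by simp

lemma conjugate_diff: "conjugate (x - y) = conjugate x - conjugate y"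
  using conjugate_dist_add[of x "- y"] by (simp add: conjugate_neg)

end

text \<open>Turns an equality of moduli into a polynomial identity in the scalars and their
  conjugates.\<close>

lemma norm_eq_iff_mult_conjugate:
  fixes x y :: "'a::real_or_complex"
  shows "norm x = norm y \<longleftrightarrow> x * conjugate x = y * conjugate y"
  unfolding mult_conjugate of_real_eq_iff by (simp add: power2_eq_iff_nonneg)

definition hinner :: "'a::{conjugate,comm_semiring_0}^'n \<Rightarrow> 'a^'n \<Rightarrow> 'a" where
  "hinner x y = (\<Sum>i\<in>UNIV. x $ i * conjugate (y $ i))"

lemma hinner_add_left: "hinner (x + y) z = hinner x z + hinner y z"
  by (simp add: hinner_def distrib_right sum.distrib)

lemma hinner_diff_left:
  fixes x :: "'a::real_or_complex^'n"
  shows "hinner (x - y) z = hinner x z - hinner y z"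
  by (simp add: hinner_def left_diff_distrib sum_subtractf)

lemma hinner_scaleR_left:
  fixes x :: "'a::real_or_complex^'n"
  shows "hinner (r *\<^sub>R x) z = of_real r * hinner x z"
  by (simp add: hinner_def sum_distrib_left scaleR_conv_of_real[where 'a='a] mult.assoc)

lemma conjugate_hinner:
  fixes x :: "'a::real_or_complex^'n"
  shows "conjugate (hinner x y) = hinner y x"
  by (simp add: hinner_def sum_conjugate conjugate_dist_mul mult.commute)

lemma hinner_self:
  fixes x :: "'a::real_or_complex^'n"
  shows "hinner x x = of_real ((norm x)\<^sup>2)"
  by (simp add: hinner_def mult_conjugate norm_vec_def L2_set_def sum_nonneg)

lemma hinner_matrix_left:
  fixes A :: "'a::real_or_complex^'n^'m"
  shows "hinner (A *v x) y = hinner x (conj_transpose A *v y)"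
proof -
  have "hinner (A *v x) y = (\<Sum>i\<in>UNIV. \<Sum>j\<in>UNIV. A $ i $ j * x $ j * conjugate (y $ i))"
    by (simp add: hinner_def matrix_vector_mult_def sum_distrib_right)
  also have "\<dots> = (\<Sum>j\<in>UNIV. \<Sum>i\<in>UNIV. A $ i $ j * x $ j * conjugate (y $ i))"
    by (rule sum.swap)
  also have "\<dots> = hinner x (conj_transpose A *v y)"
    by (simp add: hinner_def matrix_vector_mult_def conj_transpose_def sum_conjugate
        conjugate_dist_mul sum_distrib_left mult_ac)
  finally show ?thesis .
qed

lemma proj_matrix_vector_mult:
  fixes A :: "'a::real_or_complex^'n^'m"
  shows "proj (A *v x) = A ** proj x ** conj_transpose A"
proof -
  have "(A ** proj x ** conj_transpose A) $ i $ j = (A *v x) $ i * conjugate ((A *v x) $ j)" for i j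
  proof -
    have "(A ** proj x ** conj_transpose A) $ i $ j =
        (\<Sum>k\<in>UNIV. (\<Sum>l\<in>UNIV. A $ i $ l * (x $ l * conjugate (x $ k))) * conjugate (A $ j $ k))"
      by (simp add: matrix_matrix_mult_def conj_transpose_def proj_def)
    also have "\<dots> = (\<Sum>k\<in>UNIV. (A *v x) $ i * (conjugate (A $ j $ k) * conjugate (x $ k)))"
    proof (intro sum.cong refl)
      fix k
      have "(\<Sum>l\<in>UNIV. A $ i $ l * (x $ l * conjugate (x $ k))) = (A *v x) $ i * conjugate (x $ k)"
        by (simp add: matrix_vector_mult_def sum_distrib_right mult.assoc)
      then show "(\<Sum>l\<in>UNIV. A $ i $ l * (x $ l * conjugate (x $ k))) * conjugate (A $ j $ k) =
          (A *v x) $ i * (conjugate (A $ j $ k) * conjugate (x $ k))"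
        by (simp only: mult.assoc mult.commute[of "conjugate (x $ k)"])
    qed
    also have "\<dots> = (A *v x) $ i * conjugate ((A *v x) $ j)"
      by (simp add: matrix_vector_mult_def sum_conjugate conjugate_dist_mul sum_distrib_left)
    finally show ?thesis .
  qed
  then show ?thesis
    by (simp add: vec_eq_iff proj_def)
qed

text \<open>The double sum over entries factors into \<open>hinner x y\<close> and its conjugate, so
  outcome probabilities become squared moduli of inner products.\<close>

lemma trace_proj_mult_proj:
  fixes x y :: "'a::real_or_complex^'n"
  shows "trace (proj x ** proj y) = of_real ((norm (hinner x y))\<^sup>2)"
proof -
  have "trace (proj x ** proj y) =
      (\<Sum>i\<in>UNIV. \<Sum>k\<in>UNIV. (x $ i * conjugate (y $ i)) * (y $ k * conjugate (x $ k)))"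
    by (simp add: trace_def matrix_matrix_mult_def proj_def mult_ac)
  also have "\<dots> = hinner x y * conjugate (hinner x y)"
    by (simp add: conjugate_hinner) (simp add: hinner_def sum_product)
  finally show ?thesis
    by (simp add: mult_conjugate)
qed

lemma trace_proj:
  fixes x :: "'a::real_or_complex^'n"
  shows "trace (proj x) = of_real ((norm x)\<^sup>2)"
  using hinner_self[of x] by (simp add: trace_def proj_def hinner_def)

lemma psd_matrix_proj:
  fixes v :: "'a::real_or_complex^'n"
  shows "psd_matrix (proj v)"
proof -
  have "(\<Sum>i\<in>UNIV. conjugate (x $ i) * (proj v *v x) $ i) = of_real ((norm (hinner x v))\<^sup>2)" for x
  proof -
    have "(\<Sum>i\<in>UNIV. conjugate (x $ i) * (proj v *v x) $ i) = hinner v x * hinner x v"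
      by (simp add: hinner_def proj_def matrix_vector_mult_def sum_product sum_distrib_left mult_ac)
        (rule sum.swap)
    also have "\<dots> = hinner x v * conjugate (hinner x v)"
      by (simp add: conjugate_hinner mult.commute)
    finally show ?thesis
      by (simp only: mult_conjugate)
  qed
  moreover have "hermitian_matrix (proj v)"
    by (simp add: hermitian_matrix_def conj_transpose_def proj_def vec_eq_iff conjugate_dist_mul
        mult.commute)
  ultimately show ?thesis
    unfolding psd_matrix_def by (simp only: of_real_nonneg_iff) simp
qed

text \<open>Every row is a multiple of the conjugate of \<open>v\<close>, and the row at a nonzero
  coordinate of \<open>v\<close> spans that line.\<close>

lemma rank_proj:
  fixes v :: "'a::real_or_complex^'n"
  assumes "v \<noteq> 0"
  shows "rank (proj v) = 1"
proof -
  let ?w = "\<chi> j. conjugate (v $ j)"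
  obtain k where k: "v $ k \<noteq> 0"
    using assms by (auto simp: vec_eq_iff)
  then have w: "?w \<noteq> 0"
    by (auto simp: vec_eq_iff)
  have row: "row i (proj v) = v $ i *s ?w" for i
    by (simp add: row_def proj_def vec_eq_iff)
  have "vec.span (rows (proj v)) = vec.span {?w}"
  proof (intro vec.span_eq[THEN iffD2] conjI subsetI)
    fix y assume "y \<in> rows (proj v)"
    then show "y \<in> vec.span {?w}"
      unfolding rows_def row by (auto intro: vec.span_scale vec.span_base)
  next
    fix y assume "y \<in> {?w}"
    then have "y = inverse (v $ k) *s row k (proj v)"
      using k by (simp add: row vec_eq_iff)
    moreover have "row k (proj v) \<in> rows (proj v)"
      by (auto simp: rows_def)
    ultimately show "y \<in> vec.span (rows (proj v))"
      by (simp add: vec.span_scale vec.span_base)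
  qed
  then have "rank (proj v) = vec.dim {?w}"
    by (metis row_rank_def_gen vec.dim_span)
  also have "\<dots> = 1"
    using w vec.dim_eq_card_independent[of "{?w}"] by (simp add: vec.dependent_single)
  finally show ?thesis .
qed

lemma rank_mat_one: "rank (mat 1 :: 'a::field^'n^'n) = CARD('n)"
proof -
  have "rows (mat 1 :: 'a^'n^'n) = cart_basis"
  proof -
    have "row i (mat 1 :: 'a^'n^'n) = axis i 1" for i
      by (auto simp: row_def mat_def axis_def vec_eq_iff)
    then show ?thesis
      by (simp add: rows_def cart_basis_def)
  qed
  then show ?thesis
    by (simp add: row_rank_def_gen vec.dim_eq_card_independent[OF independent_cart_basis]
        card_cart_basis)
qed

lemma rank_zero_gen: "rank (0 :: 'a::field^'n^'m) = 0"
proof -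
  have "rows (0 :: 'a^'n^'m) \<subseteq> {0}"
    by (auto simp: rows_def row_def vec_eq_iff)
  then show ?thesis
    by (simp add: row_rank_def_gen)
qed

section \<open>Linear independence of vital POVMs\<close>

lemma trace_matrix_mult_sum:
  fixes A :: "'a::comm_semiring_1^'n^'n"
  shows "trace (A ** (\<Sum>i\<in>I. F i)) = (\<Sum>i\<in>I. trace (A ** F i))"
proof (induction I rule: infinite_finite_induct)
  case (insert i I)
  then show ?case
    by (simp add: matrix_add_ldistrib trace_add)
qed (simp_all add: trace_def matrix_matrix_mult_def)

lemma trace_matrix_mult_scaleR:
  fixes A :: "'a::real_normed_field^'n^'n"
  shows "trace (A ** (c *\<^sub>R B)) = of_real c * trace (A ** B)"
  by (simp add: trace_def matrix_matrix_mult_def sum_distrib_left scaleR_conv_of_real[where 'a='a]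
      mult_ac)

text \<open>The trace against a fixed matrix is real-linear, so proportional statistics on
  \<open>X\<close> stay proportional, with the same factor, on its span.\<close>

lemma trace_matrix_mult_span:
  fixes A B :: "'a::real_normed_field^'n^'n"
  assumes "H \<in> span X" and eq: "\<And>Y. Y \<in> X \<Longrightarrow> trace (A ** Y) = t * trace (B ** Y)"
  shows "trace (A ** H) = t * trace (B ** H)"
  using assms(1)
proof (induction rule: span_induct_alt)
  case base
  then show ?case
    by (simp add: trace_def matrix_matrix_mult_def)
next
  case (step c x y)
  then show ?case
    by (simp add: matrix_add_ldistrib trace_add trace_matrix_mult_scaleR eq algebra_simps)
qed

lemma psd_matrix_diag_nonneg:
  assumes "psd_matrix (A :: 'a::real_or_complex^'n^'n)"
  shows "0 \<le> A $ k $ k"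
proof -
  have "(A *v axis k 1) $ i = A $ i $ k" for i
    by (simp add: matrix_vector_mult_def axis_def if_distrib cong: if_cong)
  moreover have "conjugate (axis k 1 $ i :: 'a) = (if i = k then 1 else 0)" for i
    by (simp add: axis_def)
  ultimately have "(\<Sum>i\<in>UNIV. conjugate (axis k 1 $ i) * (A *v axis k 1) $ i) = A $ k $ k"
    by (simp add: if_distrib[of "\<lambda>c. c * _"] cong: if_cong)
  then show ?thesis
    using assms unfolding psd_matrix_def by metis
qed

text \<open>Otherwise \<open>E j\<close> would be the identity, and rank one forces dimension one.
  There the remaining elements are nonnegative scalars with sum zero, so \<open>E i\<close> would
  vanish.\<close>

lemma rank_one_povm_sum_without_nonzero:
  fixes E :: "nat \<Rightarrow> 'a::real_or_complex^'n^'n"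
  assumes povm: "rank_one_povm m E" and j: "j \<in> {1..m}" and i: "i \<in> {1..m}" "i \<noteq> j"
  shows "sum_without m E j \<noteq> 0"
proof
  assume 0: "sum_without m E j = 0"
  have psd: "psd_matrix (E k)" and rank: "rank (E k) = 1" if "k \<in> {1..m}" for k
    using povm that by (auto simp: rank_one_povm_def povm_def)
  have "(\<Sum>k=1..m. E k) = mat 1"
    using povm by (simp add: rank_one_povm_def povm_def)
  moreover have "(\<Sum>k=1..m. E k) = E j + sum_without m E j"
    using j by (simp add: sum_without_def sum.remove)
  ultimately have "rank (mat 1 :: 'a^'n^'n) = 1"
    using 0 rank[OF j] by simp
  then have one: "CARD('n) = 1"
    by (simp add: rank_mat_one)
  have "E i $ a $ b = 0" for a b
  proof -
    have "(\<Sum>k\<in>{1..m} - {j}. E k $ a $ a) = 0"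
      using arg_cong[OF 0, of "\<lambda>M. M $ a $ a"] by (simp add: sum_without_def sum_component)
    moreover have "\<forall>k\<in>{1..m} - {j}. 0 \<le> E k $ a $ a"
      using psd psd_matrix_diag_nonneg by blast
    ultimately have "E i $ a $ a = 0"
      using i by (subst (asm) sum_nonneg_eq_0_iff) auto
    moreover have "b = a"
      using one by (metis card_1_singletonE UNIV_I singletonD)
    ultimately show ?thesis
      by simp
  qed
  then have "E i = 0"
    by (simp add: vec_eq_iff)
  then show False
    using rank[OF i(1)] by (simp add: rank_zero_gen)
qed

lemma vital_not_in_span:
  fixes E :: "nat \<Rightarrow> 'a::real_or_complex^'n^'n"
  assumes vital: "vital_rank_one_povm m E" and j: "j \<in> {1..m}"
  shows "E j \<notin> span (E ` ({1..m} - {j}))"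
proof
  assume span: "E j \<in> span (E ` ({1..m} - {j}))"
  have povm: "rank_one_povm m E" and complete: "psi_complete m E"
    and not_complete: "\<not> psi_complete_without m E j"
    using vital j by (auto simp: vital_rank_one_povm_def)
  let ?S = "sum_without m E j"
  have sum: "(\<Sum>k=1..m. E k) = mat 1" and rank: "rank (E j) = 1"
    using povm j by (auto simp: rank_one_povm_def povm_def)
  have "E j \<noteq> 0"
    using rank by (auto simp: rank_zero_gen)
  then have "E ` ({1..m} - {j}) \<noteq> {}"
    using span by (metis span_empty singletonD)
  then obtain i where "i \<in> {1..m}" "i \<noteq> j"
    by blast
  then have "?S \<noteq> 0"
    using rank_one_povm_sum_without_nonzero[OF povm j] by blast
  moreover have "inj_on (\<lambda>\<rho>. \<lambda>i\<in>{1..m} - {j}. trace (\<rho> ** E i) / trace (\<rho> ** ?S))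
      (detected_states m E j)"
  proof (rule inj_onI)
    fix \<rho> \<sigma>
    assume \<rho>: "\<rho> \<in> detected_states m E j" and \<sigma>: "\<sigma> \<in> detected_states m E j"
      and eq: "(\<lambda>i\<in>{1..m} - {j}. trace (\<rho> ** E i) / trace (\<rho> ** ?S)) =
        (\<lambda>i\<in>{1..m} - {j}. trace (\<sigma> ** E i) / trace (\<sigma> ** ?S))"
    obtain x y where x: "\<rho> = proj x" "norm x = 1" and y: "\<sigma> = proj y" "norm y = 1"
      using \<rho> \<sigma> by (auto simp: detected_states_def pure_states_def)
    have nz: "trace (\<rho> ** ?S) \<noteq> 0" "trace (\<sigma> ** ?S) \<noteq> 0"
      using \<rho> \<sigma> by (auto simp: detected_states_def)
    \<comment> \<open>Equal normalised statistics are proportional raw statistics, the factor being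
      the ratio of the two detection probabilities.\<close>
    define t where "t = trace (\<rho> ** ?S) / trace (\<sigma> ** ?S)"
    have others: "trace (\<rho> ** E i) = t * trace (\<sigma> ** E i)" if "i \<in> {1..m} - {j}" for i
      using fun_cong[OF eq, of i] that nz by (simp add: t_def field_simps)
    have "trace (\<rho> ** E j) = t * trace (\<sigma> ** E j)"
      using trace_matrix_mult_span[OF span] others by blast
    with others have all: "trace (\<rho> ** E i) = t * trace (\<sigma> ** E i)" if "i \<in> {1..m}" for i
      using that by (cases "i = j") auto
    \<comment> \<open>Summing over all outcomes, \<open>E j\<close> included, gives the traces,
      which are one for pure states.\<close>
    have "trace \<rho> = t * trace \<sigma>"
    proof -
      have total: "trace \<tau> = (\<Sum>i=1..m. trace (\<tau> ** E i))" for \<tau> :: "'a^'n^'n"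
        by (simp only: trace_matrix_mult_sum[symmetric] sum matrix_mul_rid)
      show ?thesis
        unfolding total[of \<rho>] total[of \<sigma>] sum_distrib_left using all by (rule sum.cong[OF refl])
    qed
    then have "t = 1"
      using x y by (simp add: trace_proj)
    then show "\<rho> = \<sigma>"
      using complete x y all by (simp add: psi_complete_def)
  qed
  ultimately show False
    using not_complete by (simp add: psi_complete_without_def)
qed

section \<open>Counting real coordinates of Hermitian matrices\<close>

text \<open>A repeated element would lie in the span of the others. Injectivity lets the size of the
  indexed family be read off from the cardinality of its image.\<close>

lemma independent_family:
  fixes E :: "'i \<Rightarrow> 'v::real_vector"
  assumes E: "\<And>j. j \<in> I \<Longrightarrow> E j \<notin> span (E ` (I - {j}))"
  shows "inj_on E I" and "independent (E ` I)"
proof -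
  show inj: "inj_on E I"
  proof (rule inj_onI, rule ccontr)
    fix i j assume ij: "i \<in> I" "j \<in> I" "E i = E j" "i \<noteq> j"
    then have "E j \<in> E ` (I - {i})"
      by (intro imageI) simp
    then have "E i \<in> span (E ` (I - {i}))"
      unfolding \<open>E i = E j\<close> by (rule span_base)
    then show False
      using E[OF \<open>i \<in> I\<close>] by contradiction
  qed
  show "independent (E ` I)"
  proof
    assume "dependent (E ` I)"
    then obtain j where j: "j \<in> I" "E j \<in> span (E ` I - {E j})"
      unfolding dependent_def by blast
    have "E ` I - {E j} = E ` (I - {j})"
      using inj_on_image_set_diff[OF inj, of I "{j}"] \<open>j \<in> I\<close> by simp
    then show False
      using E[OF j(1)] j(2) by simp
  qed
qed

text \<open>The functionals form one linear map that is injective on \<open>span B\<close>; it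
  carries \<open>B\<close> to an independent set inside a span of \<open>card K\<close> axis
  vectors.\<close>

lemma independent_card_le_functionals:
  fixes B :: "'v::real_vector set" and f :: "'k::finite \<Rightarrow> 'v \<Rightarrow> real"
  assumes indep: "independent B" and lin: "\<And>k. k \<in> K \<Longrightarrow> linear (f k)"
    and kernel: "\<And>x. x \<in> span B \<Longrightarrow> (\<And>k. k \<in> K \<Longrightarrow> f k x = 0) \<Longrightarrow> x = 0"
  shows "card B \<le> card K"
proof -
  \<comment> \<open>Coordinates outside \<open>K\<close> are padded with zero, so the bound is
    \<open>card K\<close> and not the size of the index type.\<close>
  define g :: "'v \<Rightarrow> real^'k" where "g x = (\<chi> k. if k \<in> K then f k x else 0)" for x
  have g: "linear g"
    by (rule linearI) (auto simp: g_def vec_eq_iff linear_add[OF lin] linear_scale[OF lin])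
  have "inj_on g (span B)"
  proof (subst linear_inj_on_iff_eq_0[OF g subspace_span], intro ballI impI)
    fix x assume x: "x \<in> span B" "g x = 0"
    have "f k x = 0" if "k \<in> K" for k
      using arg_cong[OF x(2), of "\<lambda>y. y $ k"] that by (simp add: g_def)
    then show "x = 0"
      using kernel x(1) by blast
  qed
  then have ind: "independent (g ` B)" and inj: "inj_on g B"
    using linear_independent_injective_image[OF g indep] inj_on_subset span_superset by blast+
  have "g ` B \<subseteq> span ((\<lambda>k. axis k 1) ` K)"
  proof safe
    fix x
    have "g x = (\<Sum>k\<in>K. f k x *\<^sub>R axis k 1)"
      by (simp add: vec_eq_iff g_def sum_component axis_def if_distrib cong: if_cong)
    also have "\<dots> \<in> span ((\<lambda>k. axis k 1) ` K)"
      by (intro span_sum span_scale span_base) auto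
    finally show "g x \<in> span ((\<lambda>k. axis k 1) ` K)" .
  qed
  then have "card (g ` B) \<le> card ((\<lambda>k. axis k (1::real) :: real^'k) ` K)"
    using independent_span_bound[OF _ ind] by simp
  also have "\<dots> \<le> card K"
    by (rule card_image_le) simp
  finally show ?thesis
    by (simp add: card_image[OF inj])
qed

text \<open>A real subspace only: multiplication by the imaginary unit leaves it, hence spans and
  dimensions are real even for complex matrices.\<close>

lemma subspace_hermitian:
  "subspace {H :: 'a::real_or_complex^'n^'n. hermitian_matrix H}"
  by (auto simp: subspace_def hermitian_matrix_def conj_transpose_def vec_eq_iff conjugate_dist_add
      conjugate_dist_mul scaleR_conv_of_real[where 'a='a])

lemma vital_size_le:
  fixes E :: "nat \<Rightarrow> 'a::real_or_complex^'n^'n" and f :: "'k::finite \<Rightarrow> 'a^'n^'n \<Rightarrow> real"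
  assumes vital: "vital_rank_one_povm m E" and lin: "\<And>k. k \<in> K \<Longrightarrow> linear (f k)"
    and kernel: "\<And>H. hermitian_matrix H \<Longrightarrow> (\<And>k. k \<in> K \<Longrightarrow> f k H = 0) \<Longrightarrow> H = 0"
  shows "m \<le> card K"
proof -
  have E: "inj_on E {1..m}" "independent (E ` {1..m})"
    using independent_family[of "{1..m}" E] vital_not_in_span[OF vital] by blast+
  have "E ` {1..m} \<subseteq> {H. hermitian_matrix H}"
    using vital by (auto simp: vital_rank_one_povm_def rank_one_povm_def povm_def psd_matrix_def)
  then have "span (E ` {1..m}) \<subseteq> {H. hermitian_matrix H}"
    by (rule span_minimal[OF _ subspace_hermitian])
  then have "card (E ` {1..m}) \<le> card K"
    by (intro independent_card_le_functionals[OF E(2) lin] kernel) auto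
  then show ?thesis
    using card_image[OF E(1)] by simp
qed

text \<open>The relation and its converse cover all pairs and meet exactly in the diagonal.\<close>

lemma card_ordered_pairs:
  fixes h :: "'n::finite \<Rightarrow> nat"
  assumes "inj h"
  shows "card {(p, q). h p \<le> h q} = (CARD('n) + 1) choose 2"
proof -
  let ?K = "{(p, q). h p \<le> h q}"
  have "?K \<union> ?K\<inverse> = UNIV" "?K \<inter> ?K\<inverse> = (\<lambda>p. (p, p)) ` UNIV"
    by (auto simp: image_iff dest: injD[OF assms])
  then have "card ?K + card (?K\<inverse>) = CARD('n) * CARD('n) + CARD('n)"
    using card_Un_Int[of ?K "?K\<inverse>"] by (simp add: card_image inj_on_def card_prod)
  then have "2 * card ?K = CARD('n) * (CARD('n) + 1)"
    by (simp add: card_inverse)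
  then show ?thesis
    by (simp add: choose_two)
qed

lemma vital_real_size_le:
  fixes E :: "nat \<Rightarrow> real^'n^'n"
  assumes "vital_rank_one_povm m E"
  shows "m \<le> (CARD('n) + 1) choose 2"
proof -
  let ?h = "to_nat :: 'n \<Rightarrow> nat"
  \<comment> \<open>The numbering of the indices orders them; the entries on and above the diagonal
    determine a symmetric matrix.\<close>
  have "m \<le> card {(p, q). ?h p \<le> ?h q}"
  proof (rule vital_size_le[OF assms])
    show "linear (\<lambda>H :: real^'n^'n. H $ fst k $ snd k)" for k
      by (rule linearI) simp_all
    fix H :: "real^'n^'n"
    assume H: "hermitian_matrix H"
      and 0: "\<And>k. k \<in> {(p, q). ?h p \<le> ?h q} \<Longrightarrow> H $ fst k $ snd k = 0"
    have "H $ p $ q = 0" for p q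
    proof -
      have "H $ q $ p = H $ p $ q"
        using H by (simp add: hermitian_matrix_def conj_transpose_def vec_eq_iff)
      then show ?thesis
        using 0[of "(p, q)"] 0[of "(q, p)"] by fastforce
    qed
    then show "H = 0"
      by (simp add: vec_eq_iff)
  qed
  then show ?thesis
    by (simp add: card_ordered_pairs)
qed

lemma vital_complex_size_le:
  fixes E :: "nat \<Rightarrow> complex^'n^'n"
  assumes "vital_rank_one_povm m E"
  shows "m \<le> CARD('n)\<^sup>2"
proof -
  let ?h = "to_nat :: 'n \<Rightarrow> nat"
  \<comment> \<open>Real parts on and above the diagonal and imaginary parts below it determine a
    Hermitian matrix, whose diagonal is real.\<close>
  let ?f = "\<lambda>(p, q) (H :: complex^'n^'n). if ?h p \<le> ?h q then Re (H $ p $ q) else Im (H $ p $ q)"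
  have "m \<le> card (UNIV :: ('n \<times> 'n) set)"
  proof (rule vital_size_le[OF assms])
    show "linear (?f k)" for k
      by (rule linearI) (auto split: prod.split)
    fix H :: "complex^'n^'n"
    assume H: "hermitian_matrix H" and 0: "\<And>k. k \<in> UNIV \<Longrightarrow> ?f k H = 0"
    have "H $ p $ q = 0" for p q
    proof -
      have "H $ q $ p = cnj (H $ p $ q)"
        using H by (simp add: hermitian_matrix_def conj_transpose_def vec_eq_iff)
      moreover have "?h p < ?h q \<or> ?h q < ?h p \<or> p = q"
        by (metis linorder_neqE_nat to_nat_split)
      ultimately show ?thesis
        using 0[of "(p, q)"] 0[of "(q, p)"] by (auto simp: complex_eq_iff split: if_splits)
    qed
    then show "H = 0"
      by (simp add: vec_eq_iff)
  qed
  then show ?thesis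
    by (simp add: card_prod power2_eq_square)
qed

section \<open>Vital POVMs of maximal size\<close>

lemma matrix_add_rdistrib:
  fixes A :: "'a::semiring_1^'n^'m"
  shows "(A + B) ** C = A ** C + B ** C"
  by (simp add: vec_eq_iff matrix_matrix_mult_def distrib_right sum.distrib)

text \<open>The witnesses need not be unit vectors, since their norms cancel in the normalised
  statistics. If both gave the same state, outcome \<open>i\<close> would force equal norms of
  \<open>x\<close> and \<open>y\<close>, and outcome \<open>j\<close> would then contradict
  \<open>neq\<close>.\<close>

lemma not_psi_complete_withoutI:
  fixes w :: "nat \<Rightarrow> 'a::real_or_complex^'n"
  assumes E: "\<And>i. i \<in> {1..m} \<Longrightarrow> E i = proj (w i)" and j: "j \<in> {1..m}"
    and eq: "\<And>i. i \<in> {1..m} - {j} \<Longrightarrow> norm (hinner x (w i)) = norm (hinner y (w i))"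
    and i: "i \<in> {1..m} - {j}" and nz: "hinner x (w i) \<noteq> 0"
    and neq: "norm (hinner x (w j)) \<noteq> norm (hinner y (w j))"
  shows "\<not> psi_complete_without m E j"
proof
  assume complete: "psi_complete_without m E j"
  let ?I = "{1..m} - {j}"
  let ?u = "\<lambda>z. (1 / norm z) *\<^sub>R z"
  let ?p = "\<lambda>z i. (norm (hinner z (w i)))\<^sup>2 / (norm z)\<^sup>2"
  have "x \<noteq> 0" "y \<noteq> 0"
    using nz eq[OF i] by (auto simp: hinner_def)
  then have unit: "norm (?u x) = 1" "norm (?u y) = 1" and pos: "norm x > 0" "norm y > 0"
    by simp_all
  have trace: "trace (proj (?u z) ** E i) = of_real (?p z i)" if "i \<in> {1..m}" for z i
  proof -
    have "norm (hinner (?u z) (w i)) = norm (hinner z (w i)) / norm z"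
      by (simp add: hinner_scaleR_left norm_mult norm_divide)
    then show ?thesis
      by (simp only: E[OF that] trace_proj_mult_proj power_divide)
  qed
  have total: "trace (proj (?u z) ** sum_without m E j) = of_real (\<Sum>i\<in>?I. ?p z i)" for z
    by (simp add: sum_without_def trace_matrix_mult_sum trace del: of_real_divide of_real_power)
  have sum_pos: "(\<Sum>i\<in>?I. ?p z i) > 0" if "norm z > 0" "hinner z (w i) \<noteq> 0" for z
    using i that by (intro sum_pos2[of ?I i]) auto
  have detected: "proj (?u z) \<in> detected_states m E j"
    if "norm (?u z) = 1" "norm z > 0" "hinner z (w i) \<noteq> 0" for z
    using that sum_pos[OF that(2,3)]
    by (auto simp: detected_states_def pure_states_def total of_real_pos_iff
        simp del: of_real_sum of_real_divide of_real_power)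
  have ratio: "?p z k / (\<Sum>i\<in>?I. ?p z i) =
      (norm (hinner z (w k)))\<^sup>2 / (\<Sum>i\<in>?I. (norm (hinner z (w i)))\<^sup>2)" if "norm z > 0" for z k
    using that by (simp add: sum_divide_distrib[symmetric])
  have eq_total: "(\<Sum>i\<in>?I. (norm (hinner x (w i)))\<^sup>2) = (\<Sum>i\<in>?I. (norm (hinner y (w i)))\<^sup>2)"
    by (rule sum.cong) (simp_all add: eq)
  have "?p x k / (\<Sum>i\<in>?I. ?p x i) = ?p y k / (\<Sum>i\<in>?I. ?p y i)" if "k \<in> ?I" for k
    unfolding ratio[OF pos(1)] ratio[OF pos(2)] using eq[OF that] eq_total by simp
  then have "(\<lambda>i\<in>?I. trace (proj (?u x) ** E i) / trace (proj (?u x) ** sum_without m E j)) =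
      (\<lambda>i\<in>?I. trace (proj (?u y) ** E i) / trace (proj (?u y) ** sum_without m E j))"
    by (intro restrict_ext) (simp add: trace total del: of_real_sum of_real_divide of_real_power
        add: of_real_divide[symmetric])
  moreover have "hinner y (w i) \<noteq> 0"
    using nz eq[OF i] by auto
  ultimately have "proj (?u x) = proj (?u y)"
    using complete detected[OF unit(1) pos(1) nz] detected[OF unit(2) pos(2)]
    unfolding psi_complete_without_def by (blast dest: inj_onD)
  then have p: "?p x k = ?p y k" if "k \<in> {1..m}" for k
    using trace[OF that, of x] trace[OF that, of y] by (metis of_real_eq_iff)
  have "(norm x)\<^sup>2 = (norm y)\<^sup>2"
    using p[of i] i nz eq[OF i] pos by (auto simp: field_simps)
  then have "(norm (hinner x (w j)))\<^sup>2 = (norm (hinner y (w j)))\<^sup>2"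
    using p[OF j] pos by simp
  then show False
    using neq by simp
qed

text \<open>
  Passing from vectors whose rank-one operators sum to an arbitrary positive operator to a POVM:
  the congruence by \<open>T\<close> preserves both separation of pure states and its failure after
  removal of one vector, since \<open>hinner x (T *v v) = hinner (T *v x) v\<close>.
\<close>

lemma vital_rank_one_povm_of_vectors:
  fixes v :: "'k \<Rightarrow> 'a::real_or_complex^'n"
  assumes fin: "finite K" and nz: "\<And>k. k \<in> K \<Longrightarrow> v k \<noteq> 0"
    and T: "conj_transpose T = T" "T ** (\<Sum>k\<in>K. proj (v k)) ** T = mat 1"
    and separating: "\<And>x y. (\<And>k. k \<in> K \<Longrightarrow> norm (hinner x (v k)) = norm (hinner y (v k))) \<Longrightarrow>
      proj x = proj y"
    and removal: "\<And>k. k \<in> K \<Longrightarrow> K = {k} \<or>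
      (\<exists>x y. (\<forall>l\<in>K - {k}. norm (hinner x (v l)) = norm (hinner y (v l))) \<and>
        (\<exists>l\<in>K - {k}. hinner x (v l) \<noteq> 0) \<and> norm (hinner x (v k)) \<noteq> norm (hinner y (v k)))"
  shows "\<exists>E :: nat \<Rightarrow> 'a^'n^'n. vital_rank_one_povm (card K) E"
proof -
  obtain h where h: "bij_betw h {1..card K} K"
    using ex_bij_betw_nat_finite_1[OF fin] by blast
  define m where "m = card K"
  note h = h[folded m_def]
  have hK: "h i \<in> K" if "i \<in> {1..m}" for i
    using h that by (auto simp: bij_betw_def)
  \<comment> \<open>This is the inverse of \<open>T\<close>: a right inverse by the normalisation of
    \<open>T\<close>, hence two-sided for square matrices.\<close>
  define R where "R = (\<Sum>k\<in>K. proj (v k)) ** T"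
  have TR: "T ** R = mat 1"
    using T(2) by (simp add: R_def matrix_mul_assoc)
  then have RT: "R ** T = mat 1"
    by (rule matrix_left_right_inverse1)
  define w where "w i = T *v v (h i)" for i
  define E where "E i = proj (w i)" for i
  have hinner_w: "hinner x (w i) = hinner (T *v x) (v (h i))" for x i
    by (simp add: w_def hinner_matrix_left T(1))
  have T_inj: "T *v x = 0 \<longleftrightarrow> x = 0" for x
    by (metis RT matrix_vector_mul_assoc matrix_vector_mul_lid matrix_vector_mult_0_right)
  have "(\<Sum>i=1..m. E i) = (\<Sum>k\<in>K. T ** proj (v k) ** T)"
    using sum.reindex_bij_betw[OF h, of "\<lambda>k. T ** proj (v k) ** T"]
    by (simp add: E_def w_def proj_matrix_vector_mult T(1))
  also have "\<dots> = T ** (\<Sum>k\<in>K. proj (v k)) ** T"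
    by (induction K rule: infinite_finite_induct)
      (simp_all add: matrix_add_ldistrib matrix_add_rdistrib)
  finally have "rank_one_povm m E"
    using T(2) nz[OF hK]
    by (simp add: rank_one_povm_def povm_def E_def psd_matrix_proj rank_proj w_def T_inj)
  moreover have "psi_complete m E"
    unfolding psi_complete_def
  proof (intro allI impI)
    fix x y
    assume eq: "\<forall>i\<in>{1..m}. trace (proj x ** E i) = trace (proj y ** E i)"
    have "proj (T *v x) = proj (T *v y)"
    proof (rule separating)
      fix k assume "k \<in> K"
      then obtain i where i: "i \<in> {1..m}" "k = h i"
        using h by (auto simp: bij_betw_def)
      then show "norm (hinner (T *v x) (v k)) = norm (hinner (T *v y) (v k))"
        using bspec[OF eq i(1)]
        by (simp add: E_def trace_proj_mult_proj hinner_w of_real_eq_iff del: of_real_power)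
    qed
    then have "proj (R *v (T *v x)) = proj (R *v (T *v y))"
      by (simp only: proj_matrix_vector_mult[of R])
    then show "proj x = proj y"
      by (simp add: matrix_vector_mul_assoc RT)
  qed
  moreover have "\<not> psi_complete_without m E j" if j: "j \<in> {1..m}" for j
  proof (cases "K = {h j}")
    case True
    \<comment> \<open>A POVM with a single element is settled by the convention for a zero
      remainder.\<close>
    then have "{1..m} - {j} = {}"
      using j by (auto simp: m_def)
    then have "sum_without m E j = 0"
      by (simp only: sum_without_def sum.empty)
    then show ?thesis
      by (simp add: psi_complete_without_def)
  next
    case False
    then obtain x y k where eq: "\<forall>l\<in>K - {h j}. norm (hinner x (v l)) = norm (hinner y (v l))"
      and k: "k \<in> K - {h j}" "hinner x (v k) \<noteq> 0"
      and neq: "norm (hinner x (v (h j))) \<noteq> norm (hinner y (v (h j)))"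
      using removal[OF hK[OF j]] by blast
    have hj: "h i \<in> K - {h j}" if "i \<in> {1..m} - {j}" for i
      using hK[of i] that j inj_on_contraD[OF bij_betw_imp_inj_on[OF h], of i j] by auto
    have "k \<in> h ` {1..m}"
      using k(1) bij_betw_imp_surj_on[OF h] by blast
    then obtain i where i: "i \<in> {1..m} - {j}" "k = h i"
      using k(1) by blast
    \<comment> \<open>Applying \<open>R\<close> moves the removal witnesses for the vectors
      \<open>v\<close> to witnesses for the normalised vectors \<open>w\<close>.\<close>
    have hinner_R: "hinner (R *v z) (w i) = hinner z (v (h i))" for z i
      by (simp add: hinner_w matrix_vector_mul_assoc TR)
    show ?thesis
    proof (rule not_psi_complete_withoutI[OF _ j])
      show "E i = proj (w i)" for i
        by (simp add: E_def)
      show "norm (hinner (R *v x) (w i)) = norm (hinner (R *v y) (w i))"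
        if "i \<in> {1..m} - {j}" for i
        using eq hj[OF that] by (simp add: hinner_R)
      show "i \<in> {1..m} - {j}"
        by (rule i)
      show "hinner (R *v x) (w i) \<noteq> 0"
        using k i by (simp add: hinner_R)
      show "norm (hinner (R *v x) (w j)) \<noteq> norm (hinner (R *v y) (w j))"
        using neq by (simp add: hinner_R)
    qed
  qed
  ultimately show ?thesis
    unfolding m_def[symmetric] vital_rank_one_povm_def by blast
qed

section \<open>Inverse square roots in the algebra spanned by the identity and the all-ones
  matrix\<close>

text \<open>\<open>a\<close> times the identity plus \<open>b\<close> times the all-ones matrix;
  such matrices are closed under products because the square of the all-ones matrix is a multiple of
  it.\<close>

definition uniform_matrix :: "real \<Rightarrow> real \<Rightarrow> 'a::real_normed_field^'n^'n" where
  "uniform_matrix a b = (\<chi> i j. of_real (if i = j then a + b else b))"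

lemma uniform_matrix_mult:
  "(uniform_matrix a b :: 'a::real_normed_field^'n^'n) ** uniform_matrix c d =
    uniform_matrix (a * c) (a * d + b * c + real CARD('n) * b * d)"
proof -
  have "(\<Sum>k\<in>UNIV. (if i = k then a + b else b) * (if k = j then c + d else d)) =
      (if i = j then a * c + (a * d + b * c + real CARD('n) * b * d)
       else a * d + b * c + real CARD('n) * b * d)" for i j :: 'n
  proof -
    have "(\<Sum>k\<in>UNIV. (if i = k then a + b else b) * (if k = j then c + d else d)) =
        (\<Sum>k\<in>UNIV. (if k = i then (if i = j then a * c else 0) + a * d else 0) +
          ((if k = j then b * c else 0) + b * d))"
      by (rule sum.cong) (auto simp: algebra_simps)
    also have "\<dots> = (if i = j then a * c else 0) + a * d + (b * c + real CARD('n) * (b * d))"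
      by (simp add: sum.distrib)
    finally show ?thesis
      by simp
  qed
  then show ?thesis
    by (simp add: vec_eq_iff uniform_matrix_def matrix_matrix_mult_def of_real_mult[symmetric]
        of_real_sum[symmetric] del: of_real_mult of_real_sum of_real_add)
qed

text \<open>The matrix has eigenvalue \<open>c + n\<close> on the all-ones vector and
  \<open>c\<close> on its orthogonal complement. \<open>T\<close> has the inverse square roots
  \<open>s\<close> and \<open>a\<close> there, so \<open>b\<close> is chosen with
  \<open>a + n * b = s\<close>.\<close>

lemma uniform_matrix_inverse_sqrt:
  assumes "c > 0"
  obtains T :: "'a::real_or_complex^'n^'n"
  where "conj_transpose T = T" "T ** uniform_matrix c 1 ** T = mat 1"
proof -
  define n where "n = real CARD('n)"
  define a where "a = 1 / sqrt c"
  define s where "s = 1 / sqrt (c + n)"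
  define b where "b = (s - a) / n"
  have n: "n > 0"
    by (simp add: n_def)
  have a: "a * a * c = 1" and s: "s * s * (c + n) = 1" and nb: "n * b = s - a"
    using assms n by (simp_all add: a_def s_def b_def)
  \<comment> \<open>\<open>n\<close> times the all-ones coefficient of the product is the difference
    of its two eigenvalues, both equal to one.\<close>
  have "n * (a * c * b + (a * 1 + b * c + n * b * 1) * a + n * (a * 1 + b * c + n * b * 1) * b)
      = s * s * (c + n) - a * a * c"
    using nb by algebra
  then have off: "a * c * b + (a * 1 + b * c + n * b * 1) * a + n * (a * 1 + b * c + n * b * 1) * b = 0"
    using a s n by simp
  let ?T = "uniform_matrix a b :: 'a^'n^'n"
  have "?T ** uniform_matrix c 1 ** ?T = uniform_matrix 1 0"
    unfolding uniform_matrix_mult n_def[symmetric] off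
    using a by (simp add: mult_ac)
  also have "\<dots> = mat 1"
    by (simp add: uniform_matrix_def mat_def vec_eq_iff)
  finally show thesis
    using that[of ?T] by (simp add: uniform_matrix_def conj_transpose_def vec_eq_iff)
qed

text \<open>
  The vectors \<open>2 e_p\<close> and \<open>e_p + \<omega> e_q\<close> for \<open>(p, q)\<close> in \<open>K\<close>. In the real case \<open>\<omega> = 1\<close> and \<open>K\<close>
  contains one orientation of every edge; in the complex case \<open>\<omega> = exp (i \<pi> / 3)\<close> and \<open>K\<close> contains
  both. The phase is chosen so that the off-diagonal entries of the sum of the rank-one
  operators are \<open>1\<close> in both cases (\<open>\<omega> + cnj \<omega> = 1\<close>), and the factor \<open>2\<close> so that this sum is
  positive definite also in dimension one.
\<close>

locale edge_vectors =
  fixes K :: "('n::finite \<times> 'n) set" and \<omega> :: "'a::real_or_complex" and g t :: real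
  assumes diag: "(p, p) \<in> K"
    and norm_omega: "norm \<omega> = 1"
    and t_nonneg: "0 \<le> t"
    and orientations: "p \<noteq> q \<Longrightarrow> of_bool ((p, q) \<in> K) + of_bool ((q, p) \<in> K) = t"
    and off_diag: "p \<noteq> q \<Longrightarrow>
      (if (p, q) \<in> K then conjugate \<omega> else 0) + (if (q, p) \<in> K then \<omega> else 0) = 1"
    and g: "of_real g * (\<omega> + conjugate \<omega>) = 2"
    and separating: "\<lbrakk>p \<noteq> q; (p, q) \<in> K \<Longrightarrow> conjugate \<omega> * d + \<omega> * conjugate d = 0;
      (q, p) \<in> K \<Longrightarrow> \<omega> * d + conjugate \<omega> * conjugate d = 0\<rbrakk> \<Longrightarrow> d = 0"
    and edge_removal: "\<lbrakk>p \<noteq> q; (p, q) \<in> K\<rbrakk> \<Longrightarrow>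
      \<exists>c. \<omega> * conjugate c + conjugate \<omega> * c \<noteq> 0 \<and>
        ((q, p) \<in> K \<longrightarrow> \<omega> * c + conjugate \<omega> * conjugate c = 0)"
begin

definition edge_vector :: "'n \<times> 'n \<Rightarrow> 'a^'n" where
  "edge_vector = (\<lambda>(p, q). \<chi> i. if p = q then (if i = p then 2 else 0)
     else if i = p then 1 else if i = q then \<omega> else 0)"

lemma omega_mult_conjugate: "\<omega> * conjugate \<omega> = 1" "conjugate \<omega> * \<omega> = 1"
  using mult_conjugate[of \<omega>] norm_omega by (simp_all add: mult.commute)

lemma hinner_edge_vector:
  "hinner x (edge_vector (p, q)) = (if p = q then 2 * x $ p else x $ p + conjugate \<omega> * x $ q)"
proof (cases "p = q")
  case True
  have "hinner x (edge_vector (p, q)) = (\<Sum>i\<in>UNIV. if i = p then 2 * x $ i else 0)"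
    unfolding hinner_def edge_vector_def using True by (intro sum.cong refl) simp
  then show ?thesis
    using True by simp
next
  case False
  have "hinner x (edge_vector (p, q)) =
      (\<Sum>i\<in>UNIV. (if i = p then x $ i else 0) + (if i = q then conjugate \<omega> * x $ i else 0))"
    unfolding hinner_def edge_vector_def using False
    by (intro sum.cong refl) (simp add: mult.commute)
  then show ?thesis
    using False by (simp add: sum.distrib)
qed

lemma edge_vector_eq_0: "i \<noteq> p \<Longrightarrow> i \<noteq> q \<Longrightarrow> edge_vector (p, q) $ i = 0"
  by (simp add: edge_vector_def)

lemma edge_vector_nonzero: "edge_vector k \<noteq> 0"
proof -
  obtain p q where "k = (p, q)"
    by (cases k)
  then have "edge_vector k $ p \<noteq> 0"
    by (simp add: edge_vector_def)
  then show ?thesis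
    by auto
qed

text \<open>Only the two orientations of the edge between \<open>a\<close> and \<open>b\<close> have
  both coordinates nonzero; \<open>off_diag\<close> adds up their contributions.\<close>

lemma sum_proj_edge_vector_off_diag:
  assumes "a \<noteq> b"
  shows "(\<Sum>k\<in>K. edge_vector k $ a * conjugate (edge_vector k $ b)) = 1"
proof -
  have "(\<Sum>k\<in>K. edge_vector k $ a * conjugate (edge_vector k $ b)) =
      (\<Sum>k\<in>{(a, b), (b, a)}. if k \<in> K then edge_vector k $ a * conjugate (edge_vector k $ b) else 0)"
  proof (rule sum.mono_neutral_cong)
    fix k assume k: "k \<in> K - {(a, b), (b, a)}"
    obtain p q where pq: "k = (p, q)"
      by (cases k)
    with k assms consider "a \<noteq> p" "a \<noteq> q" | "b \<noteq> p" "b \<noteq> q"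
      by auto
    then show "edge_vector k $ a * conjugate (edge_vector k $ b) = 0"
      by cases (simp_all add: pq edge_vector_eq_0)
  qed auto
  also have "\<dots> = 1"
    using assms off_diag[OF assms] by (auto simp: edge_vector_def add.commute split: if_splits)
  finally show ?thesis .
qed

text \<open>The loop at \<open>a\<close> contributes 4. Each other vertex contributes
  \<open>t\<close>, the number of orientations of its edge to \<open>a\<close> that lie in
  \<open>K\<close>, as \<open>\<omega>\<close> has modulus one.\<close>

lemma sum_proj_edge_vector_diag:
  "(\<Sum>k\<in>K. edge_vector k $ a * conjugate (edge_vector k $ a)) =
    of_real (4 + real (CARD('n) - 1) * t)"
proof -
  let ?f = "\<lambda>k. of_bool (k \<in> K) * (edge_vector k $ a * conjugate (edge_vector k $ a))"
  let ?U = "UNIV - {a}"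
  have "insert (a, a) (Pair a ` ?U \<union> (\<lambda>q. (q, a)) ` ?U) = {(p, q). p = a \<or> q = a}"
    by (auto simp: image_iff)
  then have "(\<Sum>k\<in>K. edge_vector k $ a * conjugate (edge_vector k $ a)) =
      (\<Sum>k\<in>insert (a, a) (Pair a ` ?U \<union> (\<lambda>q. (q, a)) ` ?U). ?f k)"
    by (simp only:) (rule sum.mono_neutral_cong, auto simp: edge_vector_eq_0)
  also have "\<dots> = ?f (a, a) + (\<Sum>k\<in>Pair a ` ?U \<union> (\<lambda>q. (q, a)) ` ?U. ?f k)"
    by (rule sum.insert) auto
  also have "(\<Sum>k\<in>Pair a ` ?U \<union> (\<lambda>q. (q, a)) ` ?U. ?f k) =
      (\<Sum>k\<in>Pair a ` ?U. ?f k) + (\<Sum>k\<in>(\<lambda>q. (q, a)) ` ?U. ?f k)"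
    by (rule sum.union_disjoint) auto
  also have "(\<Sum>k\<in>Pair a ` ?U. ?f k) = (\<Sum>q\<in>?U. ?f (a, q))"
    by (rule sum.reindex_cong[OF _ refl refl]) (simp add: inj_on_def)
  also have "(\<Sum>k\<in>(\<lambda>q. (q, a)) ` ?U. ?f k) = (\<Sum>q\<in>?U. ?f (q, a))"
    by (rule sum.reindex_cong[OF _ refl refl]) (simp add: inj_on_def)
  also have "?f (a, a) = 4"
    by (simp add: diag edge_vector_def)
  also have "(\<Sum>q\<in>?U. ?f (a, q)) + (\<Sum>q\<in>?U. ?f (q, a)) = (\<Sum>q\<in>?U. ?f (a, q) + ?f (q, a))"
    by (rule sum.distrib[symmetric])
  also have "(\<Sum>q\<in>?U. ?f (a, q) + ?f (q, a)) = (\<Sum>q\<in>?U. of_real t)"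
  proof (rule sum.cong[OF refl])
    fix q assume "q \<in> ?U"
    then have "a \<noteq> q"
      by auto
    then show "?f (a, q) + ?f (q, a) = of_real t"
      by (simp add: edge_vector_def omega_mult_conjugate flip: orientations[OF \<open>a \<noteq> q\<close>])
  qed
  finally show ?thesis
    by (simp add: card_Diff_singleton)
qed

lemma sum_proj_edge_vector:
  "(\<Sum>k\<in>K. proj (edge_vector k)) = uniform_matrix (3 + real (CARD('n) - 1) * t) 1"
  by (simp add: vec_eq_iff proj_def uniform_matrix_def sum_component sum_proj_edge_vector_off_diag
      sum_proj_edge_vector_diag)

text \<open>Loops fix the diagonal of \<open>proj x\<close>. Given these, the edge
  \<open>(p, q)\<close> fixes the real part of \<open>conjugate \<omega>\<close> times an
  off-diagonal entry; \<open>separating\<close> says that the available orientations then fix the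
  entry itself.\<close>

lemma separating_edge_vector:
  assumes eq: "\<And>k. k \<in> K \<Longrightarrow> norm (hinner x (edge_vector k)) = norm (hinner y (edge_vector k))"
  shows "proj x = proj y"
proof -
  have diag_eq: "x $ p * conjugate (x $ p) = y $ p * conjugate (y $ p)" for p
    using eq[OF diag[of p]]
    by (simp add: hinner_edge_vector norm_mult norm_eq_iff_mult_conjugate)
  have cross: "conjugate \<omega> * (x $ q * conjugate (x $ p) - y $ q * conjugate (y $ p)) +
      \<omega> * conjugate (x $ q * conjugate (x $ p) - y $ q * conjugate (y $ p)) = 0"
    if "p \<noteq> q" "(p, q) \<in> K" for p q
  proof -
    have expand: "hinner z (edge_vector (p, q)) * conjugate (hinner z (edge_vector (p, q))) =
        z $ p * conjugate (z $ p) + (\<omega> * conjugate \<omega>) * (z $ q * conjugate (z $ q)) +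
        (conjugate \<omega> * (z $ q * conjugate (z $ p)) + \<omega> * conjugate (z $ q * conjugate (z $ p)))" for z
      using \<open>p \<noteq> q\<close>
      by (simp add: hinner_edge_vector conjugate_dist_add conjugate_dist_mul algebra_simps)
    have "hinner x (edge_vector (p, q)) * conjugate (hinner x (edge_vector (p, q))) =
        hinner y (edge_vector (p, q)) * conjugate (hinner y (edge_vector (p, q)))"
      using eq[OF that(2)] by (simp only: norm_eq_iff_mult_conjugate)
    then show ?thesis
      unfolding expand diag_eq by (simp add: conjugate_diff algebra_simps)
  qed
  have "x $ q * conjugate (x $ p) = y $ q * conjugate (y $ p)" if "p \<noteq> q" for p q
  proof -
    let ?d = "x $ q * conjugate (x $ p) - y $ q * conjugate (y $ p)"
    have "?d = 0"
    proof (rule separating[OF that])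
      show "conjugate \<omega> * ?d + \<omega> * conjugate ?d = 0" if "(p, q) \<in> K"
        using cross[OF \<open>p \<noteq> q\<close> that] .
      show "\<omega> * ?d + conjugate \<omega> * conjugate ?d = 0" if "(q, p) \<in> K"
        using cross[OF \<open>p \<noteq> q\<close>[symmetric] that]
        by (simp add: conjugate_diff conjugate_dist_mul algebra_simps)
    qed
    then show ?thesis
      by simp
  qed
  then show ?thesis
    using diag_eq by (auto simp: proj_def vec_eq_iff) metis
qed

section \<open>Witnesses for the removal of one vector\<close>

text \<open>The squared moduli differ by twice the cross term, which is the trace of
  \<open>proj v\<close> against x u* + u x*.\<close>

lemma norm_hinner_add_eq_diff_iff:
  fixes x u v :: "'a^'m"
  shows "norm (hinner (x + u) v) = norm (hinner (x - u) v) \<longleftrightarrow>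
    hinner x v * conjugate (hinner u v) + conjugate (hinner x v) * hinner u v = 0"
proof -
  let ?X = "hinner x v" and ?U = "hinner u v"
  have "norm (?X + ?U) = norm (?X - ?U) \<longleftrightarrow>
      2 * (?X * conjugate ?U + conjugate ?X * ?U) = 0"
    unfolding norm_eq_iff_mult_conjugate
    by (auto simp: conjugate_diff conjugate_dist_add algebra_simps)
  also have "\<dots> \<longleftrightarrow> ?X * conjugate ?U + conjugate ?X * ?U = 0"
    by (simp only: mult_eq_0_iff) simp
  finally show ?thesis
    by (simp only: hinner_add_left hinner_diff_left)
qed

text \<open>
  Removing \<open>2 e_p\<close>, respectively \<open>e_p + \<omega> e_q\<close>, is witnessed by \<open>x + u\<close> and \<open>x - u\<close> where \<open>x = e_p\<close>:
  the element dual to the removed operator is \<open>x u\<^sup>* + u x\<^sup>*\<close> up to a scalar.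
\<close>

lemma removal_diag:
  assumes "q \<noteq> p"
  shows "\<exists>x y. (\<forall>l\<in>K - {(p, p)}. norm (hinner x (edge_vector l)) = norm (hinner y (edge_vector l))) \<and>
    (\<exists>l\<in>K - {(p, p)}. hinner x (edge_vector l) \<noteq> 0) \<and>
    norm (hinner x (edge_vector (p, p))) \<noteq> norm (hinner y (edge_vector (p, p)))"
proof (intro exI conjI)
  let ?x = "axis p 1 :: 'a^'n"
  \<comment> \<open>On an edge at \<open>p\<close> in either orientation the cross term is 2 -
    \<open>g\<close> (\<open>\<omega>\<close> + \<open>conjugate \<omega>\<close>), which vanishes
    by the choice of \<open>g\<close>; all other vectors except the loop at \<open>p\<close> are
    orthogonal to \<open>?x\<close>. At that loop, \<open>?x - ?u\<close> gives zero and
    \<open>?x + ?u\<close> does not.\<close>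
  let ?u = "(\<chi> i. if i = p then 1 else - of_real g) :: 'a^'n"
  have g': "of_real g * \<omega> + of_real g * conjugate \<omega> = 2"
    using g by (simp add: distrib_left)
  then have "g \<noteq> 0"
    by auto
  show "\<forall>l\<in>K - {(p, p)}. norm (hinner (?x + ?u) (edge_vector l)) =
      norm (hinner (?x - ?u) (edge_vector l))"
  proof
    fix l assume "l \<in> K - {(p, p)}"
    moreover obtain r s where "l = (r, s)"
      by (cases l)
    ultimately show "norm (hinner (?x + ?u) (edge_vector l)) =
        norm (hinner (?x - ?u) (edge_vector l))"
      unfolding norm_hinner_add_eq_diff_iff using g'
      by (auto simp: hinner_edge_vector axis_def conjugate_dist_add conjugate_dist_mul conjugate_neg
          omega_mult_conjugate algebra_simps)
  qed
  show "\<exists>l\<in>K - {(p, p)}. hinner (?x + ?u) (edge_vector l) \<noteq> 0"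
    using assms diag[of q] \<open>g \<noteq> 0\<close>
    by (intro bexI[of _ "(q, q)"]) (auto simp: hinner_edge_vector axis_def)
  show "norm (hinner (?x + ?u) (edge_vector (p, p))) \<noteq>
      norm (hinner (?x - ?u) (edge_vector (p, p)))"
    by (simp add: hinner_edge_vector axis_def)
qed

lemma removal_edge:
  assumes "p \<noteq> q" "(p, q) \<in> K"
  shows "\<exists>x y. (\<forall>l\<in>K - {(p, q)}. norm (hinner x (edge_vector l)) = norm (hinner y (edge_vector l))) \<and>
    (\<exists>l\<in>K - {(p, q)}. hinner x (edge_vector l) \<noteq> 0) \<and>
    norm (hinner x (edge_vector (p, q))) \<noteq> norm (hinner y (edge_vector (p, q)))"
proof -
  obtain c where c: "\<omega> * conjugate c + conjugate \<omega> * c \<noteq> 0"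
      "(q, p) \<in> K \<Longrightarrow> \<omega> * c + conjugate \<omega> * conjugate c = 0"
    using edge_removal[OF assms] by blast
  \<comment> \<open>Only the two orientations of this edge see both \<open>p\<close> and
    \<open>q\<close>; \<open>c\<close> annihilates the cross term of \<open>(q, p)\<close>, if
    present, but not that of \<open>(p, q)\<close>.\<close>
  let ?x = "axis p 1 :: 'a^'n" and ?u = "axis q c :: 'a^'n"
  show ?thesis
  proof (intro exI conjI)
    show "\<forall>l\<in>K - {(p, q)}. norm (hinner (?x + ?u) (edge_vector l)) =
        norm (hinner (?x - ?u) (edge_vector l))"
    proof
      fix l assume "l \<in> K - {(p, q)}"
      moreover obtain r s where "l = (r, s)"
        by (cases l)
      ultimately show "norm (hinner (?x + ?u) (edge_vector l)) =
          norm (hinner (?x - ?u) (edge_vector l))"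
        unfolding norm_hinner_add_eq_diff_iff using c(2) assms
        by (auto simp: hinner_edge_vector axis_def conjugate_dist_mul algebra_simps)
    qed
    show "\<exists>l\<in>K - {(p, q)}. hinner (?x + ?u) (edge_vector l) \<noteq> 0"
      using assms diag[of p]
      by (intro bexI[of _ "(p, p)"]) (auto simp: hinner_edge_vector axis_def)
    show "norm (hinner (?x + ?u) (edge_vector (p, q))) \<noteq>
        norm (hinner (?x - ?u) (edge_vector (p, q)))"
      unfolding norm_hinner_add_eq_diff_iff using c(1) assms
      by (simp add: hinner_edge_vector axis_def conjugate_dist_mul)
  qed
qed

theorem vital_rank_one_povm_exists: "\<exists>E :: nat \<Rightarrow> 'a^'n^'n. vital_rank_one_povm (card K) E"
proof -
  have "3 + real (CARD('n) - 1) * t > 0"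
    using t_nonneg by (simp add: add_pos_nonneg)
  then obtain T :: "'a^'n^'n" where T: "conj_transpose T = T"
      "T ** uniform_matrix (3 + real (CARD('n) - 1) * t) 1 ** T = mat 1"
    by (rule uniform_matrix_inverse_sqrt)
  show ?thesis
  proof (rule vital_rank_one_povm_of_vectors[of K edge_vector T])
    show "finite K"
      by simp
    show "edge_vector k \<noteq> 0" for k
      by (rule edge_vector_nonzero)
    show "conj_transpose T = T" "T ** (\<Sum>k\<in>K. proj (edge_vector k)) ** T = mat 1"
      using T by (simp_all add: sum_proj_edge_vector)
    show "proj x = proj y"
      if "\<And>k. k \<in> K \<Longrightarrow> norm (hinner x (edge_vector k)) = norm (hinner y (edge_vector k))" for x y
      using that by (rule separating_edge_vector)
    fix k assume k: "k \<in> K"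
    obtain p q where pq: "k = (p, q)"
      by (cases k)
    show "K = {k} \<or> (\<exists>x y.
        (\<forall>l\<in>K - {k}. norm (hinner x (edge_vector l)) = norm (hinner y (edge_vector l))) \<and>
        (\<exists>l\<in>K - {k}. hinner x (edge_vector l) \<noteq> 0) \<and>
        norm (hinner x (edge_vector k)) \<noteq> norm (hinner y (edge_vector k)))"
    proof (cases "p = q")
      case True
      show ?thesis
      \<comment> \<open>A second vertex supplies the witness; in dimension one the loop is the only
        vector.\<close>
      proof (cases "\<exists>r. r \<noteq> p")
        case True
        then show ?thesis
          using removal_diag pq \<open>p = q\<close> by blast
      next
        case False
        then have "r = p" for r
          by blast
        then have "l = k" for l
          using pq by (metis prod.exhaust)
        then have "K = {k}"
          using k by blast
        then show ?thesis ..
      qed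
    next
      case False
      then show ?thesis
        using removal_edge k pq by blast
    qed
  qed
qed

end

section \<open>The real and the complex instance\<close>

lemma vital_real_exists:
  "\<exists>E :: nat \<Rightarrow> real^'n^'n. vital_rank_one_povm ((CARD('n::finite) + 1) choose 2) E"
proof -
  let ?h = "to_nat :: 'n \<Rightarrow> nat"
  let ?K = "{(p, q). ?h p \<le> ?h q}"
  have total: "?h p < ?h q \<or> ?h q < ?h p" if "p \<noteq> q" for p q
    using that by (metis linorder_neqE_nat to_nat_split)
  \<comment> \<open>Each edge has one orientation in \<open>?K\<close>, so \<open>t\<close> is 1;
    the phase 1 gives \<open>g\<close> = 1.\<close>
  interpret edge_vectors ?K "1 :: real" 1 1
  proof
    fix p q :: 'n
    assume "p \<noteq> q"
    from total[OF this] consider "?h p < ?h q" "\<not> ?h q \<le> ?h p" | "?h q < ?h p" "\<not> ?h p \<le> ?h q"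
      by linarith
    note cases = this
    from cases show "of_bool ((p, q) \<in> ?K) + of_bool ((q, p) \<in> ?K) = (1 :: real)"
      by cases simp_all
    from cases show "(if (p, q) \<in> ?K then conjugate 1 else 0) + (if (q, p) \<in> ?K then 1 else 0) = (1 :: real)"
      by cases simp_all
    from cases show "d = 0" if "(p, q) \<in> ?K \<Longrightarrow> conjugate 1 * d + 1 * conjugate d = 0"
        "(q, p) \<in> ?K \<Longrightarrow> 1 * d + conjugate 1 * conjugate d = 0" for d :: real
      using that by cases simp_all
    assume "(p, q) \<in> ?K"
    with cases have "(q, p) \<notin> ?K"
      by cases simp_all
    then show "\<exists>c::real. 1 * conjugate c + conjugate 1 * c \<noteq> 0 \<and>
        ((q, p) \<in> ?K \<longrightarrow> 1 * c + conjugate 1 * conjugate c = 0)"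
      by (intro exI[of _ 1]) simp
  qed simp_all
  show ?thesis
    using vital_rank_one_povm_exists by (simp add: card_ordered_pairs)
qed

lemma vital_complex_exists:
  "\<exists>E :: nat \<Rightarrow> complex^'n^'n. vital_rank_one_povm (CARD('n::finite)\<^sup>2) E"
proof -
  define \<omega> where "\<omega> = Complex (1 / 2) (sqrt 3 / 2)"
  \<comment> \<open>Here \<open>\<omega>\<close> plus its conjugate is 1, so \<open>g\<close> = 2;
    both orientations are present, so \<open>t\<close> = 2.\<close>
  interpret edge_vectors "UNIV :: ('n \<times> 'n) set" \<omega> 2 2
  proof
    show "norm \<omega> = 1"
      by (simp add: \<omega>_def cmod_def power_divide)
    fix p q :: 'n and d :: complex
    assume "(p, q) \<in> UNIV \<Longrightarrow> conjugate \<omega> * d + \<omega> * conjugate d = 0"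
      "(q, p) \<in> UNIV \<Longrightarrow> \<omega> * d + conjugate \<omega> * conjugate d = 0"
    \<comment> \<open>Both \<open>\<omega> * d\<close> and \<open>cnj \<omega> * d\<close> are
      purely imaginary, which forces \<open>d = 0\<close> since \<open>\<omega>\<close> has nonzero
      real and imaginary parts.\<close>
    then show "d = 0"
      by (auto simp: \<omega>_def complex_eq_iff)
  next
    fix p q :: 'n
    \<comment> \<open>The witness is exp(i pi/6): times \<open>\<omega>\<close> it is the imaginary
      unit, while times \<open>cnj \<omega>\<close> it has real part
      \<open>sqrt 3 / 2\<close>.\<close>
    have "\<omega> * conjugate (Complex (sqrt 3 / 2) (1 / 2)) + conjugate \<omega> * Complex (sqrt 3 / 2) (1 / 2) \<noteq> 0"
      "\<omega> * Complex (sqrt 3 / 2) (1 / 2) + conjugate \<omega> * conjugate (Complex (sqrt 3 / 2) (1 / 2)) = 0"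
      by (simp_all add: \<omega>_def complex_eq_iff)
    then show "\<exists>c. \<omega> * conjugate c + conjugate \<omega> * c \<noteq> 0 \<and>
        ((q, p) \<in> UNIV \<longrightarrow> \<omega> * c + conjugate \<omega> * conjugate c = 0)"
      by blast
  qed (auto simp: \<omega>_def complex_eq_iff)
  show ?thesis
    using vital_rank_one_povm_exists by (simp add: card_prod power2_eq_square)
qed

theorem theorem3p1:
  shows "(\<forall>m (E :: nat \<Rightarrow> real^'n^'n). vital_rank_one_povm m E \<longrightarrow> m \<le> (CARD('n::finite) + 1) choose 2)
    \<and> (\<forall>m (E :: nat \<Rightarrow> complex^'n^'n). vital_rank_one_povm m E \<longrightarrow> m \<le> CARD('n)^2)
    \<and> (\<exists>E :: nat \<Rightarrow> real^'n^'n. vital_rank_one_povm ((CARD('n) + 1) choose 2) E)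
    \<and> (\<exists>E :: nat \<Rightarrow> complex^'n^'n. vital_rank_one_povm (CARD('n)^2) E)"
  by (intro conjI allI impI vital_real_size_le vital_complex_size_le vital_real_exists
      vital_complex_exists)

end
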